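(* Let $G$ be a residually finite group. If $G$ is not allosteric, then every minimal dynamical system $(X,G)$ with an ergodic invariant measure $\mu$ in which the stabilizers $G_x$, $x\in X$, are finite has no essential holonomy with respect to $\mu$.
   Context: A dynamical system $(X,G)$ is a countable discrete finitely generated group $G$ acting by homeomorphisms on a compact Hausdorff space $X$. It is minimal if $X$ is the only non-empty closed $G$-invariant subset of $X$. An invariant measure is a $G$-invariant Borel probability measure $\mu$ on $X$; it is ergodic if $\mu(A)\in\{0,1\}$ for every invariant Borel set $A$. The stabilizer of $x\in X$ is $G_x=\{g\in G: gx=x\}$. A point $x\in X$ has trivial holonomy if for every $g\in G_x$ there is an open neighborhood $V$ of $x$ such that $g$ fixes every point of $V$. $(X,G,\mu)$ has no essential holonomy if $\mu$-a.e. point has trivial holonomy. $(X,G)$ is topologically free if the set of points with trivial stabilizer is residual; $(X,G,\mu)$ is essentially free if $\mu$-a.e. point has trivial stabilizer. A group $G$ is allosteric if there is a minimal topologically free action of $G$ on a compact Hausdorff space, with an ergodic measure with respect to which it is not essentially free. *)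

theory Defs
  imports
    "HOL-Probability.Probability"
    "HOL-Algebra.Group_Action"
    "HOL-Algebra.Generated_Groups"
begin

no_notation eq_closure_of (\<open>closure'_of\<index>\<close>)

section \<open>Groups\<close>

definition finitely_generated_group :: "('g, 'm) monoid_scheme \<Rightarrow> bool" where
  "finitely_generated_group G \<longleftrightarrow>
     group G \<and> (\<exists>S. finite S \<and> S \<subseteq> carrier G \<and> generate G S = carrier G)"

definition residually_finite_group :: "('g, 'm) monoid_scheme \<Rightarrow> bool" where
  "residually_finite_group G \<longleftrightarrow>
     group G \<and>
     (\<forall>g \<in> carrier G. g \<noteq> \<one>\<^bsub>G\<^esub> \<longrightarrow> (\<exists>N. N \<lhd> G \<and> finite (rcosets\<^bsub>G\<^esub> N) \<and> g \<notin> N))"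

section \<open>Dynamical systems\<close>

text \<open>\<^locale>\<open>group_action\<close> takes the maps \<open>\<phi> g\<close> to be \<^const>\<open>undefined\<close> outside the
  phase space; this only normalises irrelevant values.\<close>

definition dynamical_system ::
  "('g, 'm) monoid_scheme \<Rightarrow> 'x topology \<Rightarrow> ('g \<Rightarrow> 'x \<Rightarrow> 'x) \<Rightarrow> bool" where
  "dynamical_system G X \<phi> \<longleftrightarrow>
     finitely_generated_group G \<and> countable (carrier G) \<and>
     compact_space X \<and> Hausdorff_space X \<and>
     group_action G (topspace X) \<phi> \<and>
     (\<forall>g \<in> carrier G. homeomorphic_map X X (\<phi> g))"

definition invariant_set ::
  "('g, 'm) monoid_scheme \<Rightarrow> ('g \<Rightarrow> 'x \<Rightarrow> 'x) \<Rightarrow> 'x set \<Rightarrow> bool" where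
  "invariant_set G \<phi> A \<longleftrightarrow> (\<forall>g \<in> carrier G. \<phi> g ` A = A)"

definition minimal_system ::
  "('g, 'm) monoid_scheme \<Rightarrow> 'x topology \<Rightarrow> ('g \<Rightarrow> 'x \<Rightarrow> 'x) \<Rightarrow> bool" where
  "minimal_system G X \<phi> \<longleftrightarrow>
     topspace X \<noteq> {} \<and>
     (\<forall>C. closedin X C \<and> C \<noteq> {} \<and> invariant_set G \<phi> C \<longrightarrow> C = topspace X)"

section \<open>Invariant and ergodic measures\<close>

definition borel_of :: "'x topology \<Rightarrow> 'x measure" where
  "borel_of X = sigma (topspace X) {U. openin X U}"

definition invariant_measure ::
  "('g, 'm) monoid_scheme \<Rightarrow> 'x topology \<Rightarrow> ('g \<Rightarrow> 'x \<Rightarrow> 'x) \<Rightarrow> 'x measure \<Rightarrow> bool" where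
  "invariant_measure G X \<phi> M \<longleftrightarrow>
     sets M = sets (borel_of X) \<and> prob_space M \<and>
     (\<forall>g \<in> carrier G. \<forall>A \<in> sets M. emeasure M (\<phi> g ` A) = emeasure M A)"

definition ergodic_measure ::
  "('g, 'm) monoid_scheme \<Rightarrow> 'x topology \<Rightarrow> ('g \<Rightarrow> 'x \<Rightarrow> 'x) \<Rightarrow> 'x measure \<Rightarrow> bool" where
  "ergodic_measure G X \<phi> M \<longleftrightarrow>
     invariant_measure G X \<phi> M \<and>
     (\<forall>A \<in> sets M. invariant_set G \<phi> A \<longrightarrow> emeasure M A \<in> {0, 1})"

section \<open>Holonomy and freeness\<close>

definition trivial_holonomy ::
  "('g, 'm) monoid_scheme \<Rightarrow> 'x topology \<Rightarrow> ('g \<Rightarrow> 'x \<Rightarrow> 'x) \<Rightarrow> 'x \<Rightarrow> bool" where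
  "trivial_holonomy G X \<phi> x \<longleftrightarrow>
     (\<forall>g \<in> stabilizer G \<phi> x. \<exists>V. openin X V \<and> x \<in> V \<and> (\<forall>y \<in> V. \<phi> g y = y))"

definition no_essential_holonomy ::
  "('g, 'm) monoid_scheme \<Rightarrow> 'x topology \<Rightarrow> ('g \<Rightarrow> 'x \<Rightarrow> 'x) \<Rightarrow> 'x measure \<Rightarrow> bool" where
  "no_essential_holonomy G X \<phi> M \<longleftrightarrow> (AE x in M. trivial_holonomy G X \<phi> x)"

definition residual_in :: "'x topology \<Rightarrow> 'x set \<Rightarrow> bool" where
  "residual_in X S \<longleftrightarrow>
     S \<subseteq> topspace X \<and>
     (\<exists>U :: nat \<Rightarrow> 'x set.
        (\<forall>n. openin X (U n) \<and> X closure_of (U n) = topspace X) \<and> (\<Inter>n. U n) \<subseteq> S)"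

definition topologically_free ::
  "('g, 'm) monoid_scheme \<Rightarrow> 'x topology \<Rightarrow> ('g \<Rightarrow> 'x \<Rightarrow> 'x) \<Rightarrow> bool" where
  "topologically_free G X \<phi> \<longleftrightarrow>
     residual_in X {x \<in> topspace X. stabilizer G \<phi> x = {\<one>\<^bsub>G\<^esub>}}"

definition essentially_free ::
  "('g, 'm) monoid_scheme \<Rightarrow> ('g \<Rightarrow> 'x \<Rightarrow> 'x) \<Rightarrow> 'x measure \<Rightarrow> bool" where
  "essentially_free G \<phi> M \<longleftrightarrow> (AE x in M. stabilizer G \<phi> x = {\<one>\<^bsub>G\<^esub>})"

section \<open>Allosteric groups\<close>

definition allosteric_action ::
  "('g, 'm) monoid_scheme \<Rightarrow> 'x topology \<Rightarrow> ('g \<Rightarrow> 'x \<Rightarrow> 'x) \<Rightarrow> 'x measure \<Rightarrow> bool" where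
  "allosteric_action G X \<phi> M \<longleftrightarrow>
     dynamical_system G X \<phi> \<and> minimal_system G X \<phi> \<and> topologically_free G X \<phi> \<and>
     ergodic_measure G X \<phi> M \<and> \<not> essentially_free G \<phi> M"

text \<open>The phase space of an allosteric action may be any compact Hausdorff space, but HOL
  cannot quantify over types. Nothing is lost by taking its points in \<^typ>\<open>nat set set\<close>: the
  acting group is countable, so a minimal system has a countable dense orbit, and a Hausdorff
  space with a dense sequence injects into \<^typ>\<open>nat set set\<close>. The lemma
  \<open>allostericI\<close> below proves that an allosteric action on a space over any type whatsoever
  makes the group allosteric.\<close>

definition allosteric :: "('g, 'm) monoid_scheme \<Rightarrow> bool" where
  "allosteric G \<longleftrightarrow>
     (\<exists>(X :: nat set set topology) \<phi> M. allosteric_action G X \<phi> M)"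

lemma space_borel_of [simp]: "space (borel_of X) = topspace X"
  and sets_borel_of: "sets (borel_of X) = sigma_sets (topspace X) {U. openin X U}"
  unfolding borel_of_def by (auto intro!: space_measure_of sets_measure_of dest: openin_subset)

lemma continuous_map_measurable:
  assumes "continuous_map X Y f"
  shows "f \<in> measurable (borel_of X) (borel_of Y)"
proof (unfold borel_of_def[of Y], rule measurable_measure_of)
  show "{U. openin Y U} \<subseteq> Pow (topspace Y)" by (auto dest: openin_subset)
  show "f \<in> space (borel_of X) \<rightarrow> topspace Y"
    using assms by (auto simp: continuous_map_def)
  fix V assume "V \<in> {U. openin Y U}"
  then have "openin X {x \<in> topspace X. f x \<in> V}"
    using assms by (auto simp: continuous_map_def)
  moreover have "f -` V \<inter> space (borel_of X) = {x \<in> topspace X. f x \<in> V}" by auto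
  ultimately show "f -` V \<inter> space (borel_of X) \<in> sets (borel_of X)"
    by (simp add: sets_borel_of sigma_sets.Basic)
qed

lemma minimal_imp_inj_nat_set_set:
  fixes G (structure) and X :: "'x topology"
  assumes ds: "dynamical_system G X \<phi>" and min: "minimal_system G X \<phi>"
  shows "\<exists>f :: 'x \<Rightarrow> nat set set. inj_on f (topspace X)"
proof -
  interpret group_action G "topspace X" \<phi> using ds by (simp add: dynamical_system_def)
  interpret group G using group_hom by (simp add: group_hom_def)
  obtain x0 where x0: "x0 \<in> topspace X" using min unfolding minimal_system_def by blast
  define e where "e n = \<phi> (from_nat_into (carrier G) n) x0" for n
  have cne: "carrier G \<noteq> {}" by auto
  have cc: "countable (carrier G)" using ds by (simp add: dynamical_system_def)
  have rng: "range e = orbit G \<phi> x0"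
  proof -
    have "range (from_nat_into (carrier G)) = carrier G"
      using range_from_nat_into[OF cne cc] .
    then have "(\<lambda>g. \<phi> g x0) ` range (from_nat_into (carrier G)) = (\<lambda>g. \<phi> g x0) ` carrier G"
      by simp
    then show ?thesis unfolding e_def orbit_def by (simp add: image_image Setcompr_eq_image)
  qed
  have sub: "orbit G \<phi> x0 \<subseteq> topspace X"
    unfolding orbit_def using element_image x0 by blast
  have inv: "\<phi> g ` orbit G \<phi> x0 = orbit G \<phi> x0" if g: "g \<in> carrier G" for g
  proof
    show "\<phi> g ` orbit G \<phi> x0 \<subseteq> orbit G \<phi> x0"
    proof
      fix y assume "y \<in> \<phi> g ` orbit G \<phi> x0"
      then obtain h where h: "h \<in> carrier G" "y = \<phi> g (\<phi> h x0)" unfolding orbit_def by auto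
      then have "y = \<phi> (g \<otimes> h) x0" using composition_rule[OF x0 g h(1)] by simp
      then show "y \<in> orbit G \<phi> x0" unfolding orbit_def using g h by blast
    qed
    show "orbit G \<phi> x0 \<subseteq> \<phi> g ` orbit G \<phi> x0"
    proof
      fix y assume "y \<in> orbit G \<phi> x0"
      then obtain h where h: "h \<in> carrier G" "y = \<phi> h x0" unfolding orbit_def by auto
      have "h = g \<otimes> (inv g \<otimes> h)" using g h by (simp add: m_assoc[symmetric])
      then have "y = \<phi> g (\<phi> (inv g \<otimes> h) x0)"
        using g h x0 composition_rule[of x0 g "inv g \<otimes> h"] by simp
      then show "y \<in> \<phi> g ` orbit G \<phi> x0" unfolding orbit_def using g h by blast
    qed
  qed
  have "invariant_set G \<phi> (X closure_of orbit G \<phi> x0)"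
    unfolding invariant_set_def
  proof
    fix g assume g: "g \<in> carrier G"
    then have "homeomorphic_map X X (\<phi> g)" using ds by (simp add: dynamical_system_def)
    from homeomorphic_map_closure_of[OF this sub] inv[OF g]
    show "\<phi> g ` (X closure_of orbit G \<phi> x0) = X closure_of orbit G \<phi> x0" by simp
  qed
  moreover have "X closure_of orbit G \<phi> x0 \<noteq> {}"
    using closure_of_subset[OF sub] rng by auto
  ultimately have dense: "X closure_of orbit G \<phi> x0 = topspace X"
    using min unfolding minimal_system_def by (meson closedin_closure_of)
  define f where "f x = {{n. e n \<in> U} |U. openin X U \<and> x \<in> U}" for x
  have "inj_on f (topspace X)"
  proof (rule inj_onI, rule ccontr)
    fix x y assume xy: "x \<in> topspace X" "y \<in> topspace X" "f x = f y" "x \<noteq> y"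
    have "Hausdorff_space X" using ds by (simp add: dynamical_system_def)
    then obtain U V where UV: "openin X U" "openin X V" "x \<in> U" "y \<in> V" "disjnt U V"
      using xy unfolding Hausdorff_space_def by meson
    have "{n. e n \<in> U} \<in> f x" unfolding f_def using UV(1,3) by blast
    then have "{n. e n \<in> U} \<in> f y" using xy(3) by simp
    then obtain U' where U': "openin X U'" "y \<in> U'" "{n. e n \<in> U} = {n. e n \<in> U'}"
      unfolding f_def by blast
    have "openin X (U' \<inter> V)" "y \<in> U' \<inter> V" using U'(1,2) UV(2,4) by auto
    then obtain z where z: "z \<in> orbit G \<phi> x0" "z \<in> U' \<inter> V"
      using dense xy(2) in_closure_of[of y X "orbit G \<phi> x0"] by metis
    then obtain n where "z = e n" using rng by blast
    then have "z \<in> U" using U'(3) z(2) by blast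
    then show False using z(2) UV(5) by (auto simp: disjnt_def)
  qed
  then show ?thesis by blast
qed

lemma allosteric_action_transport:
  fixes G (structure) and f :: "'x \<Rightarrow> 'y"
  assumes act: "allosteric_action G X \<phi> M" and inj: "inj_on f (topspace X)"
  shows "\<exists>(Y :: 'y topology) \<psi> N. allosteric_action G Y \<psi> N"
proof -
  have ds: "dynamical_system G X \<phi>" and min: "minimal_system G X \<phi>"
    and tf: "topologically_free G X \<phi>" and erg: "ergodic_measure G X \<phi> M"
    and nef: "\<not> essentially_free G \<phi> M"
    using act by (auto simp: allosteric_action_def)
  interpret group_action G "topspace X" \<phi> using ds by (simp add: dynamical_system_def)
  interpret group G using group_hom by (simp add: group_hom_def)
  define A where "A = f ` topspace X"
  define k where "k = inv_into (topspace X) f"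
  define Y where "Y = pullback_topology A k X"
  have kf: "k (f x) = x" if "x \<in> topspace X" for x
    using inj that by (simp add: k_def)
  have fk: "f (k y) = y" "k y \<in> topspace X" if "y \<in> A" for y
    using that inj by (auto simp: A_def k_def f_inv_into_f inv_into_into)
  have topY: "topspace Y = A"
    using fk by (auto simp: Y_def topspace_pullback_topology)
  have hm: "homeomorphic_maps X Y f k"
    unfolding homeomorphic_maps_def
  proof (intro conjI)
    show "continuous_map Y X k"
      unfolding Y_def using continuous_map_pullback[OF continuous_map_id, of A k X] by simp
    have "continuous_map X X (k \<circ> f)"
      by (rule continuous_map_eq[OF continuous_map_id]) (simp add: kf)
    then show "continuous_map X Y f"
      unfolding Y_def by (rule continuous_map_pullback') (auto simp: A_def)
  qed (auto simp: kf fk topY)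
  have hf: "homeomorphic_map X Y f" and hk: "homeomorphic_map Y X k"
    using hm homeomorphic_maps_map by blast+
  have homXY: "X homeomorphic_space Y" using hm homeomorphic_space_def by blast
  define \<psi> where "\<psi> g = restrict (\<lambda>y. f (\<phi> g (k y))) A" for g
  have \<psi>f: "\<psi> g (f x) = f (\<phi> g x)" if "x \<in> topspace X" for g x
    using that kf by (simp add: \<psi>_def A_def)
  have \<phi>X: "\<phi> g x \<in> topspace X" if "g \<in> carrier G" "x \<in> topspace X" for g x
    using element_image that by blast
  have hom\<psi>: "homeomorphic_map Y Y (\<psi> g)" if g: "g \<in> carrier G" for g
  proof -
    have "homeomorphic_map X X (\<phi> g)" using ds g by (simp add: dynamical_system_def)
    then have "homeomorphic_map Y Y (f \<circ> (\<phi> g \<circ> k))"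
      using hf hk homeomorphic_map_compose by metis
    then show ?thesis
      by (rule homeomorphic_map_eq) (simp add: \<psi>_def topY)
  qed
  have ga: "group_action G (topspace Y) \<psi>"
  proof -
    have Bij: "\<psi> g \<in> Bij A" if "g \<in> carrier G" for g
      using hom\<psi>[OF that]
      by (auto simp: Bij_def topY \<psi>_def homeomorphic_eq_everything_map bij_betw_def)
    have "\<psi> (g \<otimes> h) = \<psi> g \<otimes>\<^bsub>BijGroup A\<^esub> \<psi> h" if "g \<in> carrier G" "h \<in> carrier G" for g h
    proof -
      have "\<psi> (g \<otimes> h) y = compose A (\<psi> g) (\<psi> h) y" for y
      proof (cases "y \<in> A")
        case True
        then have "\<psi> h y = f (\<phi> h (k y))" by (simp add: \<psi>_def)
        moreover have "\<phi> h (k y) \<in> topspace X" using \<phi>X that fk(2)[OF True] by simp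
        ultimately have "\<psi> g (\<psi> h y) = f (\<phi> g (\<phi> h (k y)))" using \<psi>f by simp
        moreover have "\<psi> (g \<otimes> h) y = f (\<phi> (g \<otimes> h) (k y))" using True by (simp add: \<psi>_def)
        ultimately show ?thesis
          using True composition_rule[OF fk(2)[OF True] that] by (simp add: compose_def)
      next
        case False
        then show ?thesis by (simp add: compose_def \<psi>_def)
      qed
      then show ?thesis using that Bij by (auto simp: BijGroup_def)
    qed
    then have "\<psi> \<in> hom G (BijGroup A)"
      using Bij by (auto simp: hom_def BijGroup_def)
    then show ?thesis
      unfolding topY group_action_def group_hom_def group_hom_axioms_def
      using group_BijGroup is_group by blast
  qed
  have dsY: "dynamical_system G Y \<psi>"
    using ds ga hom\<psi> homXY homeomorphic_compact_space homeomorphic_Hausdorff_space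
    unfolding dynamical_system_def by blast
  have inv_iff: "invariant_set G \<phi> {x \<in> topspace X. f x \<in> C}"
    if C: "C \<subseteq> A" "invariant_set G \<psi> C" for C
    unfolding invariant_set_def
  proof
    fix g assume g: "g \<in> carrier G"
    let ?D = "{x \<in> topspace X. f x \<in> C}"
    have CD: "C = f ` ?D" using C by (auto simp: A_def)
    have "f ` (\<phi> g ` ?D) = \<psi> g ` f ` ?D"
      unfolding image_image by (rule image_cong[OF refl]) (simp add: \<psi>f)
    also have "\<dots> = f ` ?D" using C(2) g unfolding CD[symmetric] invariant_set_def by blast
    finally show "\<phi> g ` ?D = ?D"
      by (subst (asm) inj_on_image_eq_iff[OF inj]) (use \<phi>X[OF g] in auto)
  qed
  have minY: "minimal_system G Y \<psi>"
    unfolding minimal_system_def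
  proof (intro conjI allI impI)
    show "topspace Y \<noteq> {}" using min by (simp add: topY A_def minimal_system_def)
    fix C assume C: "closedin Y C \<and> C \<noteq> {} \<and> invariant_set G \<psi> C"
    then have sub: "C \<subseteq> A" using closedin_subset topY by metis
    let ?D = "{x \<in> topspace X. f x \<in> C}"
    have "closedin X ?D"
      using C hm closedin_continuous_map_preimage unfolding homeomorphic_maps_def by blast
    moreover have "?D \<noteq> {}" using C sub by (auto simp: A_def)
    ultimately have "?D = topspace X"
      using min inv_iff[OF sub] C unfolding minimal_system_def by blast
    then show "C = topspace Y" using sub by (auto simp: topY A_def)
  qed
  have stab: "stabilizer G \<psi> (f x) = stabilizer G \<phi> x" if "x \<in> topspace X" for x
    unfolding stabilizer_def using \<psi>f[OF that] \<phi>X[OF _ that] inj_on_eq_iff[OF inj _ that]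
    by (intro Collect_cong conj_cong refl) simp
  have tfY: "topologically_free G Y \<psi>"
  proof -
    let ?S = "{x \<in> topspace X. stabilizer G \<phi> x = {\<one>}}"
    obtain U :: "nat \<Rightarrow> 'x set" where U: "\<And>n. openin X (U n)"
      "\<And>n. X closure_of (U n) = topspace X" "(\<Inter>n. U n) \<subseteq> ?S"
      using tf unfolding topologically_free_def residual_in_def by blast
    have Usub: "U n \<subseteq> topspace X" for n using U(1) openin_subset by blast
    have 1: "openin Y (f ` U n)" for n
      using hf U(1) Usub homeomorphic_map_openness by blast
    have 2: "Y closure_of (f ` U n) = topspace Y" for n
      using homeomorphic_map_closure_of[OF hf Usub] U(2) by (simp add: topY A_def)
    have 3: "(\<Inter>n. f ` U n) \<subseteq> {y \<in> topspace Y. stabilizer G \<psi> y = {\<one>}}"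
    proof
      fix y assume y: "y \<in> (\<Inter>n. f ` U n)"
      have "k y \<in> U n" for n
      proof -
        obtain x where x: "x \<in> U n" "y = f x" using y by blast
        then have "k y = x" using kf Usub by blast
        then show ?thesis using x by simp
      qed
      then have "k y \<in> ?S" using U(3) by blast
      moreover have "y \<in> A" unfolding A_def using y Usub[of 0] by blast
      ultimately show "y \<in> {y \<in> topspace Y. stabilizer G \<psi> y = {\<one>}}"
        using stab[of "k y"] fk by (auto simp: topY)
    qed
    show ?thesis
      unfolding topologically_free_def residual_in_def using 1 2 3
      by (intro conjI exI[of _ "\<lambda>n. f ` U n"]) auto
  qed
  define N where "N = distr M (borel_of Y) f"
  have sM: "sets M = sets (borel_of X)" and psM: "prob_space M"
    and invM: "\<And>g B. g \<in> carrier G \<Longrightarrow> B \<in> sets M \<Longrightarrow> emeasure M (\<phi> g ` B) = emeasure M B"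
    and ergM: "\<And>B. B \<in> sets M \<Longrightarrow> invariant_set G \<phi> B \<Longrightarrow> emeasure M B \<in> {0,1}"
    using erg unfolding ergodic_measure_def invariant_measure_def by auto
  have spM: "space M = topspace X" using sets_eq_imp_space_eq[OF sM] by simp
  have fm: "f \<in> measurable M (borel_of Y)"
    using continuous_map_measurable[of X Y f] hm measurable_cong_sets[OF sM refl]
    unfolding homeomorphic_maps_def by blast
  have eN: "emeasure N B = emeasure M {x \<in> topspace X. f x \<in> B}" if "B \<in> sets N" for B
  proof -
    have "f -` B \<inter> space M = {x \<in> topspace X. f x \<in> B}" using spM by auto
    then show ?thesis using that fm by (simp add: N_def emeasure_distr)
  qed
  have pre: "{x \<in> topspace X. f x \<in> B} \<in> sets M" if "B \<in> sets N" for B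
  proof -
    have "f -` B \<inter> space M = {x \<in> topspace X. f x \<in> B}" using spM by auto
    then show ?thesis using that measurable_sets[OF fm, of B] by (simp add: N_def)
  qed
  have Nsub: "B \<subseteq> A" if "B \<in> sets N" for B
    using sets.sets_into_space[OF that] by (simp add: N_def topY)
  have imgN: "\<psi> g ` B \<in> sets N" if g: "g \<in> carrier G" and B: "B \<in> sets N" for g B
  proof -
    have hi: "homeomorphic_map Y Y (\<psi> (inv g))" using g hom\<psi> by simp
    interpret Y: group_action G "topspace Y" \<psi> by (rule ga)
    have "\<psi> g ` B = \<psi> (inv g) -` B \<inter> space (borel_of Y)"
    proof
      show "\<psi> g ` B \<subseteq> \<psi> (inv g) -` B \<inter> space (borel_of Y)"
      proof
        fix y assume "y \<in> \<psi> g ` B"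
        then obtain b where b: "b \<in> B" "y = \<psi> g b" by blast
        then have bY: "b \<in> topspace Y" using Nsub[OF B] topY by blast
        then have "y \<in> topspace Y" using Y.element_image[OF g bY] b(2) by simp
        moreover have "\<psi> (inv g) y = b" using Y.orbit_sym_aux[OF g bY] b(2) by simp
        ultimately show "y \<in> \<psi> (inv g) -` B \<inter> space (borel_of Y)" using b(1) by simp
      qed
      show "\<psi> (inv g) -` B \<inter> space (borel_of Y) \<subseteq> \<psi> g ` B"
      proof
        fix y assume y: "y \<in> \<psi> (inv g) -` B \<inter> space (borel_of Y)"
        then have "\<psi> g (\<psi> (inv g) y) = y"
          using Y.orbit_sym_aux[of "inv g" y "\<psi> (inv g) y"] g by simp
        then show "y \<in> \<psi> g ` B" using y by (metis IntD1 imageI vimageD)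
      qed
    qed
    moreover have "\<psi> (inv g) \<in> measurable (borel_of Y) (borel_of Y)"
      using hi continuous_map_measurable homeomorphic_imp_continuous_map by blast
    ultimately show ?thesis
      using measurable_sets[of "\<psi> (inv g)" "borel_of Y" "borel_of Y" B] B by (simp add: N_def)
  qed
  have invN: "emeasure N (\<psi> g ` B) = emeasure N B" if g: "g \<in> carrier G" and B: "B \<in> sets N" for g B
  proof -
    let ?D = "{x \<in> topspace X. f x \<in> B}"
    have BD: "B = f ` ?D" using Nsub[OF B] by (auto simp: A_def)
    have "\<psi> g ` B = \<psi> g ` f ` ?D"
      using BD by (rule arg_cong)
    also have "\<dots> = f ` \<phi> g ` ?D"
      unfolding image_image by (rule image_cong[OF refl]) (simp add: \<psi>f)
    finally have "{x \<in> topspace X. f x \<in> \<psi> g ` B} = {x \<in> topspace X. f x \<in> f ` \<phi> g ` ?D}"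
      by simp
    also have "\<dots> = \<phi> g ` ?D"
    proof -
      have sub: "\<phi> g ` ?D \<subseteq> topspace X" using \<phi>X[OF g] by blast
      have "f x \<in> f ` \<phi> g ` ?D \<longleftrightarrow> x \<in> \<phi> g ` ?D" if "x \<in> topspace X" for x
        by (rule inj_on_image_mem_iff[OF inj that sub])
      then have "{x \<in> topspace X. f x \<in> f ` \<phi> g ` ?D} = {x \<in> topspace X. x \<in> \<phi> g ` ?D}"
        by (intro Collect_cong conj_cong refl)
      also have "\<dots> = \<phi> g ` ?D" using sub by (simp only: Collect_conj_eq Collect_mem_eq Int_absorb1)
      finally show ?thesis .
    qed
    finally have "{x \<in> topspace X. f x \<in> \<psi> g ` B} = \<phi> g ` ?D" .
    then have "emeasure N (\<psi> g ` B) = emeasure M (\<phi> g ` ?D)"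
      using eN[OF imgN[OF g B]] by (simp only:)
    also have "\<dots> = emeasure N B"
      by (simp only: invM[OF g pre[OF B]] eN[OF B])
    finally show ?thesis .
  qed
  have ergN: "ergodic_measure G Y \<psi> N"
    unfolding ergodic_measure_def invariant_measure_def
  proof (intro conjI ballI impI)
    show "sets N = sets (borel_of Y)" by (simp add: N_def)
    show "prob_space N" unfolding N_def by (rule prob_space.prob_space_distr[OF psM fm])
    show "emeasure N B \<in> {0,1}" if "B \<in> sets N" "invariant_set G \<psi> B" for B
      using ergM[OF pre[OF that(1)] inv_iff[OF Nsub[OF that(1)] that(2)]] eN[OF that(1)] by simp
    show "emeasure N (\<psi> g ` B) = emeasure N B" if "g \<in> carrier G" "B \<in> sets N" for g B
      using invN that .
  qed
  have "\<not> essentially_free G \<psi> N"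
  proof
    assume "essentially_free G \<psi> N"
    then have "AE x in M. stabilizer G \<psi> (f x) = {\<one>}"
      unfolding essentially_free_def N_def by (rule AE_distrD[OF fm])
    then have "AE x in M. stabilizer G \<phi> x = {\<one>}"
      by (rule AE_mp) (rule AE_I2, simp add: stab spM)
    then show False using nef by (simp add: essentially_free_def)
  qed
  then have "allosteric_action G Y \<psi> N"
    using dsY minY tfY ergN by (simp add: allosteric_action_def)
  then show ?thesis by blast
qed

lemma allostericI:
  fixes X :: "'x topology"
  assumes "allosteric_action G X \<phi> M"
  shows "allosteric G"
proof -
  obtain f :: "'x \<Rightarrow> nat set set" where "inj_on f (topspace X)"
    using assms minimal_imp_inj_nat_set_set unfolding allosteric_action_def by blast
  from allosteric_action_transport[OF assms this] show ?thesis
    unfolding allosteric_def .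
qed

end

theory Submission
  imports Defs
begin

text \<open>The proof plays measure against topology. A group element in the stabilizer of \<open>x\<close> has
  trivial holonomy at \<open>x\<close> when it fixes a neighbourhood of \<open>x\<close>; these elements form a subgroup
  \<open>L\<^sub>x\<close> of \<open>G\<^sub>x\<close>, and the claim is \<open>L\<^sub>x = G\<^sub>x\<close> almost everywhere. The idea is to bound the size of
  \<open>G\<^sub>x\<close> from above by measure theory and that of \<open>L\<^sub>x\<close> from below by topology, with the same
  bound.

  A countable group has only countably many finite subgroups. As stabilizers are finite, one of
  these subgroups, say \<open>K\<close>, is the exact stabilizer on a set of positive measure. The sets on which the stabilizer is a given
  conjugate of \<open>K\<close> are translates of each other, so they have equal measure; for distinct
  conjugates they are disjoint. Hence there are only finitely many conjugates, and by ergodicity the stabilizer of almost every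
  point is one of them (\<open>ergodic_AE_stabilizer_in_finite_family\<close>).

  The points fixed pointwise by some conjugate of \<open>K\<close> form a finite union of closed sets, which
  is invariant and non-empty, hence all of \<open>X\<close>. One of the closed sets therefore has an interior
  point. The union of the interiors is open, invariant and non-empty, so it is all of
  \<open>X\<close> as well (\<open>minimal_interior_fixed_sets_cover\<close>). Thus every \<open>L\<^sub>x\<close> contains a conjugate of \<open>K\<close>,
  while almost every \<open>G\<^sub>x\<close> is a conjugate of \<open>K\<close>. Since \<open>K\<close> is finite, counting elements gives
  \<open>L\<^sub>x = G\<^sub>x\<close>.\<close>

section \<open>Conjugation of stabilizers\<close>

definition conjugate_set :: "('g, 'm) monoid_scheme \<Rightarrow> 'g \<Rightarrow> 'g set \<Rightarrow> 'g set" where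
  "conjugate_set G g F = (\<lambda>k. g \<otimes>\<^bsub>G\<^esub> k \<otimes>\<^bsub>G\<^esub> inv\<^bsub>G\<^esub> g) ` F"

lemma (in group) conjugate_set_closed:
  assumes "g \<in> carrier G" "F \<subseteq> carrier G"
  shows "conjugate_set G g F \<subseteq> carrier G"
  using assms by (auto simp: conjugate_set_def)

lemma (in group) conjugate_set_mult:
  assumes "g \<in> carrier G" "h \<in> carrier G" "F \<subseteq> carrier G"
  shows "conjugate_set G g (conjugate_set G h F) = conjugate_set G (g \<otimes> h) F"
  unfolding conjugate_set_def image_image using assms
  by (intro image_cong refl) (auto simp: m_assoc inv_mult_group subset_iff)

lemma (in group) conjugate_set_one:
  assumes "F \<subseteq> carrier G"
  shows "conjugate_set G \<one> F = F"
proof -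
  have "conjugate_set G \<one> F = (\<lambda>k. k) ` F"
    unfolding conjugate_set_def using assms by (intro image_cong refl) auto
  then show ?thesis by simp
qed

lemma (in group) card_conjugate_set:
  assumes "g \<in> carrier G" "F \<subseteq> carrier G"
  shows "card (conjugate_set G g F) = card F"
  unfolding conjugate_set_def using assms
  by (intro card_image inj_onI) (auto simp: subset_iff)

lemma conjugate_set_mono: "F \<subseteq> H \<Longrightarrow> conjugate_set G g F \<subseteq> conjugate_set G g H"
  by (auto simp: conjugate_set_def)

lemma (in group_action) conjugate_stabilizer_subset:
  assumes "x \<in> E" "g \<in> carrier G"
  shows "conjugate_set G g (stabilizer G \<phi> x) \<subseteq> stabilizer G \<phi> (\<phi> g x)"
proof -
  interpret group G using group_hom by (simp add: group_hom_def)
  have "\<phi> (g \<otimes> k \<otimes> inv g) (\<phi> g x) = \<phi> g x" if "k \<in> carrier G" "\<phi> k x = x" for k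
    using assms that element_image[of g x] orbit_sym_aux[of g x]
    by (simp add: composition_rule)
  then show ?thesis
    using assms by (auto simp: conjugate_set_def stabilizer_def)
qed

lemma (in group_action) stabilizer_translate:
  assumes x: "x \<in> E" and g: "g \<in> carrier G"
  shows "stabilizer G \<phi> (\<phi> g x) = conjugate_set G g (stabilizer G \<phi> x)"
proof
  interpret group G using group_hom by (simp add: group_hom_def)
  let ?y = "\<phi> g x"
  have y: "?y \<in> E" using element_image x g by blast
  \<comment> \<open>The inclusion that holds for any translation, applied to the inverse one, gives the
    reverse inclusion.\<close>
  have "conjugate_set G (inv g) (stabilizer G \<phi> ?y) \<subseteq> stabilizer G \<phi> x"
    using conjugate_stabilizer_subset[OF y, of "inv g"] orbit_sym_aux[OF g x] g by simp
  then have "conjugate_set G g (conjugate_set G (inv g) (stabilizer G \<phi> ?y))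
      \<subseteq> conjugate_set G g (stabilizer G \<phi> x)"
    by (rule conjugate_set_mono)
  then show "stabilizer G \<phi> ?y \<subseteq> conjugate_set G g (stabilizer G \<phi> x)"
    using g stabilizer_subset by (simp add: conjugate_set_mult conjugate_set_one)
qed (rule conjugate_stabilizer_subset[OF assms])

text \<open>Translating a set of points that is described by their stabilizers amounts to conjugating the
  description. The two descriptions used below are equality with a given set, for the measure, and
  inclusion of a given set, for the topology.\<close>

lemma (in group_action) image_stabilizer_pred:
  assumes g: "g \<in> carrier G"
    and PQ: "\<And>H. H \<subseteq> carrier G \<Longrightarrow> Q (conjugate_set G g H) \<longleftrightarrow> P H"
  shows "\<phi> g ` {x \<in> E. P (stabilizer G \<phi> x)} = {x \<in> E. Q (stabilizer G \<phi> x)}"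
proof -
  have iff: "Q (stabilizer G \<phi> (\<phi> g x)) \<longleftrightarrow> P (stabilizer G \<phi> x)" if "x \<in> E" for x
    using PQ stabilizer_subset stabilizer_translate[OF that g] by simp
  have "{y \<in> E. Q (stabilizer G \<phi> y)} = {y \<in> \<phi> g ` E. Q (stabilizer G \<phi> y)}"
    by (simp only: surj_prop[OF g])
  also have "\<dots> = \<phi> g ` {x \<in> E. P (stabilizer G \<phi> x)}"
    by (auto simp only: iff image_iff mem_Collect_eq)
  finally show ?thesis by (rule sym)
qed

lemma (in group) inj_on_conjugate_set:
  assumes "g \<in> carrier G"
  shows "inj_on (conjugate_set G g) (Pow (carrier G))"
proof (rule inj_on_inverseI)
  fix F assume "F \<in> Pow (carrier G)"
  then show "conjugate_set G (inv g) (conjugate_set G g F) = F"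
    using assms by (simp add: conjugate_set_mult conjugate_set_one)
qed

lemma (in group) conjugate_set_subset_iff:
  assumes "g \<in> carrier G" "F \<subseteq> carrier G" "H \<subseteq> carrier G"
  shows "conjugate_set G g F \<subseteq> conjugate_set G g H \<longleftrightarrow> F \<subseteq> H"
  using assms conjugate_set_mono[of "conjugate_set G g F" "conjugate_set G g H" G "inv g"]
    conjugate_set_mono[of F H G g]
  by (auto simp: conjugate_set_mult conjugate_set_one)

lemma (in group_action) image_stabilizer_eq:
  assumes "g \<in> carrier G" "F \<subseteq> carrier G"
  shows "\<phi> g ` {x \<in> E. stabilizer G \<phi> x = F}
    = {x \<in> E. stabilizer G \<phi> x = conjugate_set G g F}"
proof -
  interpret group G using group_hom by (simp add: group_hom_def)
  show ?thesis
    using assms inj_on_conjugate_set[OF assms(1)]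
    by (intro image_stabilizer_pred) (auto simp: inj_on_eq_iff)
qed

lemma (in group_action) image_subset_stabilizer:
  assumes "g \<in> carrier G" "F \<subseteq> carrier G"
  shows "\<phi> g ` {x \<in> E. F \<subseteq> stabilizer G \<phi> x}
    = {x \<in> E. conjugate_set G g F \<subseteq> stabilizer G \<phi> x}"
proof -
  interpret group G using group_hom by (simp add: group_hom_def)
  show ?thesis
    using assms by (intro image_stabilizer_pred) (auto simp: conjugate_set_subset_iff)
qed

text \<open>A family of sets indexed by conjugates and permuted by the action has an invariant union;
  below the sets are level sets of the stabilizer, closed sets of fixed points, and the interiors
  of the latter. It is enough to check one inclusion, because each group element has an
  inverse.\<close>

lemma (in group_action) invariant_set_Union_family:
  assumes sub: "\<And>F. F \<in> C \<Longrightarrow> A F \<subseteq> E"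
    and conj: "\<And>g F. g \<in> carrier G \<Longrightarrow> F \<in> C \<Longrightarrow> conjugate_set G g F \<in> C"
    and img: "\<And>g F. g \<in> carrier G \<Longrightarrow> F \<in> C \<Longrightarrow> \<phi> g ` A F \<subseteq> A (conjugate_set G g F)"
  shows "invariant_set G \<phi> (\<Union>F\<in>C. A F)"
proof -
  interpret group G using group_hom by (simp add: group_hom_def)
  let ?U = "\<Union>F\<in>C. A F"
  have fwd: "\<phi> g x \<in> ?U" if g: "g \<in> carrier G" and "x \<in> ?U" for g x
  proof -
    obtain F where F: "F \<in> C" "x \<in> A F" using \<open>x \<in> ?U\<close> by blast
    then show ?thesis using img[OF g F(1)] conj[OF g F(1)] by blast
  qed
  have bwd: "x \<in> \<phi> g ` ?U" if g: "g \<in> carrier G" and x: "x \<in> ?U" for g x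
  proof -
    have "x \<in> E" using x sub by blast
    then have "\<phi> g (\<phi> (inv g) x) = x"
      using orbit_sym_aux[of "inv g" x] g by simp
    then show ?thesis
      using fwd[OF inv_closed[OF g] x] image_eqI by metis
  qed
  have "\<phi> g ` ?U = ?U" if "g \<in> carrier G" for g
    by (intro equalityI image_subsetI subsetI fwd[OF that] bwd[OF that])
  then show ?thesis unfolding invariant_set_def by (intro ballI)
qed

section \<open>Sets of points with prescribed stabilizer\<close>

lemma closedin_fixed_points:
  assumes "Hausdorff_space X" "homeomorphic_map X X (\<phi> g)"
  shows "closedin X {x \<in> topspace X. \<phi> g x = x}"
  using closedin_continuous_maps_eq[OF assms(1) homeomorphic_imp_continuous_map[OF assms(2)]
      continuous_map_id] by simp

lemma closedin_subset_stabilizer: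
  assumes "dynamical_system G X \<phi>" "F \<subseteq> carrier G"
  shows "closedin X {x \<in> topspace X. F \<subseteq> stabilizer G \<phi> x}"
proof (cases "F = {}")
  \<comment> \<open>Over an empty index set the intersection below would be the whole type instead of the phase
    space.\<close>
  case False
  have "{x \<in> topspace X. F \<subseteq> stabilizer G \<phi> x} = (\<Inter>g\<in>F. {x \<in> topspace X. \<phi> g x = x})"
    using assms(2) False by (auto simp: stabilizer_def)
  moreover have "closedin X {x \<in> topspace X. \<phi> g x = x}" if "g \<in> F" for g
    using assms that by (intro closedin_fixed_points) (auto simp: dynamical_system_def)
  ultimately show ?thesis using False by (auto intro!: closedin_Inter)
qed auto

lemma sets_stabilizer_eq:
  assumes ds: "dynamical_system G X \<phi>" and F: "F \<subseteq> carrier G"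
  shows "{x \<in> topspace X. stabilizer G \<phi> x = F} \<in> sets (borel_of X)"
proof -
  have cl: "C \<in> sets (borel_of X)" if C: "closedin X C" for C
  proof -
    have "topspace X - C \<in> sets (borel_of X)"
      using C by (auto simp: sets_borel_of closedin_def intro: sigma_sets.Basic)
    then have "topspace X - (topspace X - C) \<in> sets (borel_of X)"
      using sets.compl_sets by fastforce
    then show ?thesis using closedin_subset[OF C] by (simp add: double_diff)
  qed
  have "{x \<in> space (borel_of X). \<forall>g\<in>carrier G. \<phi> g x = x \<longleftrightarrow> g \<in> F} \<in> sets (borel_of X)"
  proof (rule sets.sets_Collect_countable_All')
    show "countable (carrier G)" using ds by (simp add: dynamical_system_def)
    fix g assume "g \<in> carrier G"
    then have fix_g: "{x \<in> space (borel_of X). \<phi> g x = x} \<in> sets (borel_of X)"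
      using ds closedin_fixed_points[of X \<phi> g] by (auto simp: dynamical_system_def intro!: cl)
    show "{x \<in> space (borel_of X). \<phi> g x = x \<longleftrightarrow> g \<in> F} \<in> sets (borel_of X)"
      using fix_g sets.sets_Collect_neg[OF fix_g] by (cases "g \<in> F") simp_all
  qed
  moreover have "{x \<in> topspace X. stabilizer G \<phi> x = F}
      = {x \<in> space (borel_of X). \<forall>g\<in>carrier G. \<phi> g x = x \<longleftrightarrow> g \<in> F}"
    using F by (auto simp: stabilizer_def)
  ultimately show ?thesis by simp
qed

section \<open>Almost all stabilizers lie in one finite conjugacy class\<close>

lemma (in finite_measure) finite_disjoint_family_measure_ge:
  assumes disj: "disjoint_family_on A C"
    and meas: "\<And>i. i \<in> C \<Longrightarrow> A i \<in> sets M"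
    and c: "0 < c" "\<And>i. i \<in> C \<Longrightarrow> c \<le> measure M (A i)"
  shows "finite C"
proof (rule ccontr)
  assume "infinite C"
  obtain n :: nat where n: "measure M (space M) < real n * c"
    using reals_Archimedean3[OF c(1)] by blast
  obtain B where B: "B \<subseteq> C" "finite B" "card B = n"
    using infinite_arbitrarily_large[OF \<open>infinite C\<close>] by metis
  have "real n * c = (\<Sum>i\<in>B. c)" using B by simp
  also have "\<dots> \<le> (\<Sum>i\<in>B. measure M (A i))" using B c by (intro sum_mono) auto
  also have "\<dots> = measure M (\<Union>i\<in>B. A i)"
    using B meas disjoint_family_on_mono[OF B(1) disj]
    by (intro finite_measure_finite_Union[symmetric]) auto
  also have "\<dots> \<le> measure M (space M)" by (rule bounded_measure)
  finally show False using n by simp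
qed

text \<open>The family \<open>C\<close> is the conjugacy class of a finite subgroup that is the stabilizer on a set of
  positive measure. The class is finite because its members are the stabilizers on disjoint sets
  of the same positive measure, and these sets have an invariant union, which ergodicity makes
  conull. The topological part of the argument uses only that \<open>C\<close> is finite and closed under
  conjugation and that its members are finite of the same size.\<close>

lemma ergodic_AE_stabilizer_in_finite_family:
  fixes G (structure)
  assumes ds: "dynamical_system G X \<phi>" and erg: "ergodic_measure G X \<phi> M"
    and fin: "AE x in M. finite (stabilizer G \<phi> x)"
  obtains C n where "finite C"
    and "\<forall>F\<in>C. F \<subseteq> carrier G \<and> finite F \<and> card F = n"
    and "\<forall>g\<in>carrier G. \<forall>F\<in>C. conjugate_set G g F \<in> C"
    and "AE x in M. stabilizer G \<phi> x \<in> C"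
proof -
  interpret group_action G "topspace X" \<phi> using ds by (simp add: dynamical_system_def)
  interpret group G using group_hom by (simp add: group_hom_def)
  have sM: "sets M = sets (borel_of X)"
    and inv: "\<And>g A. g \<in> carrier G \<Longrightarrow> A \<in> sets M \<Longrightarrow> emeasure M (\<phi> g ` A) = emeasure M A"
    and ergM: "\<And>A. A \<in> sets M \<Longrightarrow> invariant_set G \<phi> A \<Longrightarrow> emeasure M A \<in> {0, 1}"
    using erg by (auto simp: ergodic_measure_def invariant_measure_def)
  have spM: "space M = topspace X" using sets_eq_imp_space_eq[OF sM] by simp
  interpret prob_space M
    using erg by (simp add: ergodic_measure_def invariant_measure_def)
  define A where "A F = {x \<in> topspace X. stabilizer G \<phi> x = F}" for F
  have meas: "A F \<in> sets M" if "F \<subseteq> carrier G" for F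
    unfolding A_def sM using sets_stabilizer_eq[OF ds that] .
  have "\<exists>K \<subseteq> carrier G. finite K \<and> emeasure M (A K) \<noteq> 0"
  proof (rule ccontr)
    assume none: "\<not> ?thesis"
    let ?S = "{K. finite K \<and> K \<subseteq> carrier G}"
    have "countable ?S"
      using ds countable_Collect_finite_subset by (auto simp: dynamical_system_def)
    moreover have "AE x in M. x \<notin> A K" if "K \<in> ?S" for K
      using that none meas by (intro AE_not_in null_setsI) auto
    ultimately have "AE x in M. \<forall>K\<in>?S. x \<notin> A K"
      by (intro AE_ball_countable[THEN iffD2] ballI)
    with fin AE_space have "AE x in M. False"
      by eventually_elim (use stabilizer_subset in \<open>auto simp: A_def spM\<close>)
    then show False by simp
  qed
  then obtain K where K: "K \<subseteq> carrier G" "finite K" "emeasure M (A K) \<noteq> 0" by blast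
  define C where "C = (\<lambda>g. conjugate_set G g K) ` carrier G"
  have C: "F \<subseteq> carrier G \<and> finite F \<and> card F = card K" if "F \<in> C" for F
    using that K conjugate_set_closed card_conjugate_set
    by (auto simp: C_def) (auto simp: conjugate_set_def)
  have conj: "conjugate_set G g F \<in> C" if "g \<in> carrier G" "F \<in> C" for g F
    using that K by (auto simp: C_def conjugate_set_mult)
  have "measure M (A F) = measure M (A K)" if "F \<in> C" for F
    using that K inv[OF _ meas[OF K(1)]] image_stabilizer_eq[OF _ K(1)]
    by (auto simp: C_def A_def measure_def)
  moreover have "0 < measure M (A K)"
    using K(3) by (simp add: emeasure_eq_measure zero_less_measure_iff)
  ultimately have finC: "finite C"
    using C meas
    by (intro finite_disjoint_family_measure_ge[of A C "measure M (A K)"])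
       (auto simp: disjoint_family_on_def A_def)
  let ?D = "\<Union>F\<in>C. A F"
  have D: "?D \<in> sets M" using finC C meas by (intro sets.finite_UN) auto
  have "invariant_set G \<phi> ?D"
  proof (rule invariant_set_Union_family)
    fix g F assume "g \<in> carrier G" "F \<in> C"
    then show "\<phi> g ` A F \<subseteq> A (conjugate_set G g F)"
      unfolding A_def using image_stabilizer_eq[of g F] C by simp
  qed (auto simp: A_def conj)
  then have "emeasure M ?D = 0 \<or> emeasure M ?D = 1" using ergM[OF D] by blast
  moreover have "emeasure M (A K) \<le> emeasure M ?D"
  proof (intro emeasure_mono D)
    have "K \<in> C"
      unfolding C_def by (rule image_eqI[of _ _ \<one>]) (simp_all add: conjugate_set_one K(1))
    then show "A K \<subseteq> ?D" by blast
  qed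
  ultimately have "emeasure M ?D = 1" using K(3) by (metis le_zero_eq)
  then have "prob ?D = 1" by (simp add: measure_def)
  then have "AE x in M. x \<in> ?D" using AE_in_set_eq_1[OF D] by simp
  then have "AE x in M. stabilizer G \<phi> x \<in> C" by eventually_elim (auto simp: A_def)
  moreover have "\<forall>F\<in>C. F \<subseteq> carrier G \<and> finite F \<and> card F = card K"
    by (intro ballI C)
  moreover have "\<forall>g\<in>carrier G. \<forall>F\<in>C. conjugate_set G g F \<in> C"
    by (intro ballI conj)
  ultimately show thesis by (intro that[OF finC])
qed

section \<open>Every point is an interior point of a set of fixed points\<close>

lemma minimal_system_open_invariant:
  fixes G (structure)
  assumes ds: "dynamical_system G X \<phi>" and min: "minimal_system G X \<phi>"
    and U: "openin X U" "U \<noteq> {}" "invariant_set G \<phi> U"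
  shows "U = topspace X"
proof (rule ccontr)
  interpret group_action G "topspace X" \<phi> using ds by (simp add: dynamical_system_def)
  have sub: "U \<subseteq> topspace X" using U(1) by (rule openin_subset)
  assume "U \<noteq> topspace X"
  moreover have "invariant_set G \<phi> (topspace X - U)"
    using U(3) sub inj_prop surj_prop
    by (simp add: invariant_set_def inj_on_image_set_diff[of _ "topspace X"])
  ultimately have "topspace X - U = topspace X"
    using min U(1) sub unfolding minimal_system_def by blast
  then show False using U(2) sub by blast
qed

text \<open>A single point whose stabilizer contains a member of \<open>C\<close> is enough: minimality spreads
  this to all points, since finitely many closed sets have a closed union; then one of these sets
  has an interior point, and minimality spreads that to all points in turn.\<close>

lemma minimal_interior_fixed_sets_cover:
  fixes G (structure)
  assumes ds: "dynamical_system G X \<phi>" and min: "minimal_system G X \<phi>"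
    and C: "finite C" "\<And>F. F \<in> C \<Longrightarrow> F \<subseteq> carrier G"
      "\<And>g F. g \<in> carrier G \<Longrightarrow> F \<in> C \<Longrightarrow> conjugate_set G g F \<in> C"
    and ex: "x0 \<in> topspace X" "F0 \<in> C" "F0 \<subseteq> stabilizer G \<phi> x0"
  shows "(\<Union>F\<in>C. X interior_of {x \<in> topspace X. F \<subseteq> stabilizer G \<phi> x}) = topspace X"
proof -
  interpret group_action G "topspace X" \<phi> using ds by (simp add: dynamical_system_def)
  define B where "B F = {x \<in> topspace X. F \<subseteq> stabilizer G \<phi> x}" for F
  have cl: "closedin X (B F)" if "F \<in> C" for F
    unfolding B_def using closedin_subset_stabilizer[OF ds C(2)[OF that]] .
  have img: "\<phi> g ` B F = B (conjugate_set G g F)" if "g \<in> carrier G" "F \<in> C" for g F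
    unfolding B_def using that C(2) by (intro image_subset_stabilizer)
  have "closedin X (\<Union>F\<in>C. B F)" using C(1) cl by (intro closedin_Union) auto
  moreover have "invariant_set G \<phi> (\<Union>F\<in>C. B F)"
    using C(3) img by (intro invariant_set_Union_family) (auto simp: B_def)
  moreover have "x0 \<in> (\<Union>F\<in>C. B F)" using ex by (auto simp: B_def)
  ultimately have cover: "(\<Union>F\<in>C. B F) = topspace X"
    using min unfolding minimal_system_def by blast
  have "\<exists>F\<in>C. X interior_of B F \<noteq> {}"
  proof (rule ccontr)
    assume none: "\<not> ?thesis"
    have "compact_space X" "Hausdorff_space X" using ds by (auto simp: dynamical_system_def)
    then have "locally_compact_space X \<and> regular_space X"
      using compact_imp_locally_compact_space compact_Hausdorff_imp_regular_space by blast
    then have "X interior_of \<Union>(B ` C) = {}"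
      using C(1) cl none by (intro Baire_category_alt) (auto intro: countable_finite)
    then show False using cover ex(1) by simp
  qed
  then have "(\<Union>F\<in>C. X interior_of B F) \<noteq> {}" by simp
  moreover have "openin X (\<Union>F\<in>C. X interior_of B F)"
    by (rule openin_Union) (use openin_interior_of in blast)
  moreover have "invariant_set G \<phi> (\<Union>F\<in>C. X interior_of B F)"
  proof (rule invariant_set_Union_family)
    fix g F assume gF: "g \<in> carrier G" "F \<in> C"
    then have hom: "homeomorphic_map X X (\<phi> g)" using ds by (simp add: dynamical_system_def)
    have "B F \<subseteq> topspace X" by (auto simp: B_def)
    then show "\<phi> g ` (X interior_of B F) \<subseteq> X interior_of B (conjugate_set G g F)"
      using homeomorphic_map_interior_of[OF hom] img[OF gF] by (metis order_refl)
  next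
    show "X interior_of B F \<subseteq> topspace X" for F by (rule interior_of_subset_topspace)
    show "conjugate_set G g F \<in> C" if "g \<in> carrier G" "F \<in> C" for g F
      using that by (rule C(3))
  qed
  ultimately have "(\<Union>F\<in>C. X interior_of B F) = topspace X"
    by (metis minimal_system_open_invariant[OF ds min])
  then show ?thesis unfolding B_def .
qed

section \<open>Finite stabilizers and essential holonomy\<close>

theorem AE_finite_stabilizer_imp_no_essential_holonomy:
  fixes G (structure)
  assumes ds: "dynamical_system G X \<phi>" and min: "minimal_system G X \<phi>"
    and erg: "ergodic_measure G X \<phi> M" and fin: "AE x in M. finite (stabilizer G \<phi> x)"
  shows "no_essential_holonomy G X \<phi> M"
proof -
  interpret prob_space M
    using erg by (simp add: ergodic_measure_def invariant_measure_def)
  have spM: "space M = topspace X"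
    using erg sets_eq_imp_space_eq[of M "borel_of X"]
    by (simp add: ergodic_measure_def invariant_measure_def)
  obtain C n where finC: "finite C"
    and C: "\<forall>F\<in>C. F \<subseteq> carrier G \<and> finite F \<and> card F = n"
    and conj: "\<forall>g\<in>carrier G. \<forall>F\<in>C. conjugate_set G g F \<in> C"
    and ae: "AE x in M. stabilizer G \<phi> x \<in> C"
    by (rule ergodic_AE_stabilizer_in_finite_family[OF ds erg fin])
  have "\<exists>x\<in>topspace X. stabilizer G \<phi> x \<in> C"
  proof (rule ccontr)
    assume "\<not> ?thesis"
    then have "AE x in M. stabilizer G \<phi> x \<notin> C" using spM by (intro AE_I2) auto
    with ae have "AE x in M. False" by eventually_elim simp
    then show False by simp
  qed
  then obtain x0 where x0: "x0 \<in> topspace X" "stabilizer G \<phi> x0 \<in> C" by blast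
  have cover: "(\<Union>F\<in>C. X interior_of {x \<in> topspace X. F \<subseteq> stabilizer G \<phi> x}) = topspace X"
    by (rule minimal_interior_fixed_sets_cover[OF ds min finC _ _ x0 order_refl])
       (use C conj in auto)
  have hol: "trivial_holonomy G X \<phi> x" if x: "x \<in> topspace X" "stabilizer G \<phi> x \<in> C" for x
  proof -
    obtain F where F: "F \<in> C" "x \<in> X interior_of {y \<in> topspace X. F \<subseteq> stabilizer G \<phi> y}"
      using subsetD[OF equalityD2[OF cover] x(1)] by (rule UN_E)
    let ?V = "X interior_of {y \<in> topspace X. F \<subseteq> stabilizer G \<phi> y}"
    have V: "F \<subseteq> stabilizer G \<phi> y" if "y \<in> ?V" for y
      using subsetD[OF interior_of_subset that] by simp
    \<comment> \<open>The topological lower bound and the measure-theoretic upper bound meet here: both sets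
      have \<open>n\<close> elements and the first is contained in the second.\<close>
    have "F = stabilizer G \<phi> x"
      using C F(1) x(2) by (intro card_subset_eq V F(2)) simp_all
    then have "\<phi> g y = y" if "g \<in> stabilizer G \<phi> x" "y \<in> ?V" for g y
      using V[OF that(2)] that(1) by (auto simp: stabilizer_def)
    then show ?thesis
      unfolding trivial_holonomy_def
      by (intro ballI exI[of _ ?V] conjI openin_interior_of F(2))
  qed
  show ?thesis
    unfolding no_essential_holonomy_def
    using ae AE_space by eventually_elim (simp add: hol spM)
qed

theorem corollary1p7:
  fixes G :: "('g, 'm) monoid_scheme"
    and X :: "'x topology"
    and \<phi> :: "'g \<Rightarrow> 'x \<Rightarrow> 'x"
    and M :: "'x measure"
  assumes "residually_finite_group G"
    and "\<not> allosteric G"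
    and "dynamical_system G X \<phi>"
    and "minimal_system G X \<phi>"
    and "ergodic_measure G X \<phi> M"
    and "\<And>x. x \<in> topspace X \<Longrightarrow> finite (stabilizer G \<phi> x)"
  shows "no_essential_holonomy G X \<phi> M"
proof -
  have "space M = topspace X"
    using assms(5) sets_eq_imp_space_eq[of M "borel_of X"]
    by (simp add: ergodic_measure_def invariant_measure_def)
  then have "AE x in M. finite (stabilizer G \<phi> x)"
    using assms(6) by (intro AE_I2) simp
  then show ?thesis
    by (rule AE_finite_stabilizer_imp_no_essential_holonomy[OF assms(3-5)])
qed

end
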